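(* For every integer $n\geq 1$, the path $P_n$ on $n$ vertices satisfies \[\psi_{sq}(P_{n})=\beta_{2}(P_{n})=\left\lceil\frac{2n}{3}\right\rceil .\]
   Context: All graphs are finite and simple (undirected, no loops, no multiple edges). For a graph $G=(V,E)$ and $v\in V$, $N_G[v]=\{v\}\cup\{u\in V: uv\in E\}$ is the closed neighborhood of $v$. A sub-quorum coloring of $G$ is an onto partial function $f:V\rightarrow\{1,2,\ldots,\ell\}$ such that for every vertex $v\in V$, if $f(v)$ is defined, then at least half of the vertices of $N_G[v]$ at which $f$ is defined have the same color (value of $f$) as $v$. The sub-quorum coloring number $\psi_{sq}(G)$ is the maximum value of $\ell$ over all sub-quorum colorings of $G$. A set $S\subseteq V$ is a $2$-independent set of $G$ if every vertex of $S$ has at most one neighbor in $S$; the $2$-independence number $\beta_2(G)$ is the maximum cardinality of a $2$-independent set of $G$. *)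

theory Defs
  imports Complex_Main "Graph_Theory.Pair_Digraph"
begin

text \<open>
  Finite simple graphs are those satisfying the locale predicate \<^locale>\<open>graph\<close>: finite, loop-free,
  symmetric digraphs without parallel arcs. The definitions below use \<^const>\<open>card\<close> and
  \<^const>\<open>Max\<close> and are meant for such graphs only.
\<close>

definition closed_nbhd :: "('a, 'b) pre_digraph \<Rightarrow> 'a \<Rightarrow> 'a set" where
  "closed_nbhd G v = insert v {u \<in> verts G. v \<rightarrow>\<^bsub>G\<^esub> u}"

definition sub_quorum_coloring :: "('a, 'b) pre_digraph \<Rightarrow> nat \<Rightarrow> ('a \<rightharpoonup> nat) \<Rightarrow> bool" where
  "sub_quorum_coloring G l f \<longleftrightarrow>
     dom f \<subseteq> verts G \<and> ran f = {1..l} \<and>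
     (\<forall>v \<in> dom f. card (closed_nbhd G v \<inter> dom f) \<le> 2 * card {u \<in> closed_nbhd G v \<inter> dom f. f u = f v})"

definition sub_quorum_coloring_number :: "('a, 'b) pre_digraph \<Rightarrow> nat" where
  "sub_quorum_coloring_number G = Max {l. \<exists>f. sub_quorum_coloring G l f}"

definition two_independent :: "('a, 'b) pre_digraph \<Rightarrow> 'a set \<Rightarrow> bool" where
  "two_independent G S \<longleftrightarrow> S \<subseteq> verts G \<and> (\<forall>v \<in> S. card {u \<in> S. v \<rightarrow>\<^bsub>G\<^esub> u} \<le> 1)"

definition two_independence_number :: "('a, 'b) pre_digraph \<Rightarrow> nat" where
  "two_independence_number G = Max {card S | S. two_independent G S}"

definition path_graph :: "nat \<Rightarrow> (nat, nat \<times> nat) pre_digraph" where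
  "path_graph n = with_proj \<lparr>pverts = {1..n},
     parcs = {(u, v). u \<in> {1..n} \<and> v \<in> {1..n} \<and> (v = Suc u \<or> u = Suc v)}\<rparr>"

lemma verts_path_graph [simp]: "verts (path_graph n) = {1..n}"
  by (simp add: path_graph_def)

lemma adj_path_graph:
  "u \<rightarrow>\<^bsub>path_graph n\<^esub> v \<longleftrightarrow> u \<in> {1..n} \<and> v \<in> {1..n} \<and> (v = Suc u \<or> u = Suc v)"
  by (simp add: path_graph_def)

lemma graph_path_graph: "graph (path_graph n)"
proof -
  have "finite {(u, v). u \<in> {1..n} \<and> v \<in> {1..n} \<and> (v = Suc u \<or> u = Suc v)}"
    by (rule finite_subset[of _ "{1..n} \<times> {1..n}"]) auto
  then show ?thesis
    unfolding path_graph_def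
    by unfold_locales (auto simp: symmetric_def sym_def arc_to_ends_def)
qed

text \<open>In every finite simple graph, both maxima range over finite nonempty sets.\<close>

lemma (in graph) sub_quorum_coloring_sizes:
  "finite {l. \<exists>f. sub_quorum_coloring G l f}" "{l. \<exists>f. sub_quorum_coloring G l f} \<noteq> {}"
proof -
  have "l \<le> card (verts G)" if "sub_quorum_coloring G l f" for l f
  proof -
    have d: "dom f \<subseteq> verts G" and r: "ran f = {1..l}"
      using that by (auto simp: sub_quorum_coloring_def)
    have fin: "finite (dom f)" using d finite_verts finite_subset by blast
    have "ran f = (\<lambda>x. the (f x)) ` dom f" by (force simp: ran_def dom_def)
    then have "card {1..l} \<le> card (dom f)" using card_image_le[OF fin] r by metis
    then have "l \<le> card (dom f)" by simp
    also have "\<dots> \<le> card (verts G)" using d by (simp add: card_mono)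
    finally show ?thesis .
  qed
  then have "{l. \<exists>f. sub_quorum_coloring G l f} \<subseteq> {..card (verts G)}" by auto
  then show "finite {l. \<exists>f. sub_quorum_coloring G l f}" by (rule finite_subset) simp
  have "sub_quorum_coloring G 0 Map.empty" by (simp add: sub_quorum_coloring_def)
  then show "{l. \<exists>f. sub_quorum_coloring G l f} \<noteq> {}" by blast
qed

lemma (in graph) two_independent_sizes:
  "finite {card S | S. two_independent G S}" "{card S | S. two_independent G S} \<noteq> {}"
proof -
  have "{card S | S. two_independent G S} \<subseteq> {..card (verts G)}"
    by (auto simp: two_independent_def card_mono)
  then show "finite {card S | S. two_independent G S}" by (rule finite_subset) simp
  have "two_independent G {}" by (simp add: two_independent_def)
  then show "{card S | S. two_independent G S} \<noteq> {}" by blast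
qed

end

(* A 2-independent set, colored injectively, is a sub-quorum coloring of any graph.  Conversely,
   in a graph of maximum degree 2, any system of representatives of the color classes is
   2-independent: a representative with two neighbors among the representatives would have all
   of its at most two neighbors colored differently from itself.  So both numbers agree for
   paths, and a 2-independent set of a path is one without three consecutive vertices. *)
theory Submission
  imports Defs
begin

text \<open>When only \<open>S\<close> is colored, a vertex \<open>v\<close> of \<open>S\<close>
  sees at most two colored vertices in its closed neighborhood, itself included, so \<open>v\<close>
  alone already makes up half of them.\<close>

lemma (in graph) two_independent_imp_sub_quorum_coloring:
  assumes "two_independent G S"
  shows "\<exists>f. sub_quorum_coloring G (card S) f"
proof -
  have S: "S \<subseteq> verts G" and deg: "\<And>v. v \<in> S \<Longrightarrow> card {u \<in> S. v \<rightarrow>\<^bsub>G\<^esub> u} \<le> 1"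
    using assms by (auto simp: two_independent_def)
  have fin: "finite S" using S finite_verts finite_subset by blast
  obtain h where h: "bij_betw h S {1..card S}"
    using finite_same_card_bij[OF fin, of "{1..card S}"] by auto
  define f where "f v = (if v \<in> S then Some (h v) else None)" for v
  have dom: "dom f = S" by (auto simp: f_def dom_def)
  have "ran f = h ` S" by (force simp: f_def ran_def)
  then have ran: "ran f = {1..card S}" using h by (simp add: bij_betw_def)
  have "card (closed_nbhd G v \<inter> S) \<le> 2 * card {u \<in> closed_nbhd G v \<inter> S. f u = f v}"
    if v: "v \<in> S" for v
  proof -
    have "closed_nbhd G v \<inter> S = insert v {u \<in> S. v \<rightarrow>\<^bsub>G\<^esub> u}"
      using v S by (auto simp: closed_nbhd_def)
    then have le: "card (closed_nbhd G v \<inter> S) \<le> 2"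
      using deg[OF v] fin by (simp add: card_insert_if)
    have "card {v} \<le> card {u \<in> closed_nbhd G v \<inter> S. f u = f v}"
      using v fin by (intro card_mono) (auto simp: closed_nbhd_def)
    then show ?thesis using le by simp
  qed
  then have "sub_quorum_coloring G (card S) f"
    using S by (simp add: sub_quorum_coloring_def dom ran)
  then show ?thesis by blast
qed

lemma (in graph) sub_quorum_coloring_imp_two_independent:
  assumes deg: "\<And>v. v \<in> verts G \<Longrightarrow> card {u \<in> verts G. v \<rightarrow>\<^bsub>G\<^esub> u} \<le> 2"
    and "sub_quorum_coloring G l f"
  shows "\<exists>S. two_independent G S \<and> card S = l"
proof -
  have dom: "dom f \<subseteq> verts G" and ran: "ran f = {1..l}"
    and quorum: "\<And>v. v \<in> dom f \<Longrightarrow>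
      card (closed_nbhd G v \<inter> dom f) \<le> 2 * card {u \<in> closed_nbhd G v \<inter> dom f. f u = f v}"
    using assms(2) by (auto simp: sub_quorum_coloring_def)
  have "\<forall>c\<in>{1..l}. \<exists>v. f v = Some c" using ran by (auto simp: ran_def)
  then obtain g where g: "\<And>c. c \<in> {1..l} \<Longrightarrow> f (g c) = Some c" by metis
  define S where "S = g ` {1..l}"
  have "inj_on g {1..l}" by (rule inj_onI) (metis g option.inject)
  then have card: "card S = l" by (simp add: S_def card_image)
  have Sdom: "S \<subseteq> dom f" using g by (auto simp: S_def)
  have inj: "u = v" if "u \<in> S" "v \<in> S" "f u = f v" for u v
    using that g by (metis S_def imageE option.inject)
  have "card {u \<in> S. v \<rightarrow>\<^bsub>G\<^esub> u} \<le> 1" if v: "v \<in> S" for v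
  proof (rule ccontr)
    assume "\<not> card {u \<in> S. v \<rightarrow>\<^bsub>G\<^esub> u} \<le> 1"
    then have ge: "2 \<le> card {u \<in> S. v \<rightarrow>\<^bsub>G\<^esub> u}" by simp
    \<comment> \<open>The degree bound enters here: two neighbors inside \<open>S\<close> exhaust
      the neighborhood, so \<open>v\<close> has no neighbor outside \<open>S\<close> that could
      share its color.\<close>
    have eq: "{u \<in> S. v \<rightarrow>\<^bsub>G\<^esub> u} = {u \<in> verts G. v \<rightarrow>\<^bsub>G\<^esub> u}"
    proof (rule card_seteq)
      show "card {u \<in> verts G. v \<rightarrow>\<^bsub>G\<^esub> u} \<le> card {u \<in> S. v \<rightarrow>\<^bsub>G\<^esub> u}"
        using deg[of v] ge v Sdom dom by fastforce
    qed (use Sdom dom in auto)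
    then have nb: "closed_nbhd G v = insert v {u \<in> S. v \<rightarrow>\<^bsub>G\<^esub> u}"
      by (simp add: closed_nbhd_def)
    have "v \<notin> {u \<in> S. v \<rightarrow>\<^bsub>G\<^esub> u}" using adj_not_same by blast
    moreover have "finite {u \<in> S. v \<rightarrow>\<^bsub>G\<^esub> u}" using eq by simp
    \<comment> \<open>All of these at least three vertices are colored, but only \<open>v\<close>
      has its own color, so the quorum condition would give 3 \<le> 2.\<close>
    ultimately have "3 \<le> card (closed_nbhd G v)" using ge by (simp add: nb)
    moreover have "closed_nbhd G v \<inter> dom f = closed_nbhd G v" using nb v Sdom by auto
    moreover have "{u \<in> closed_nbhd G v. f u = f v} = {v}" using nb v inj by auto
    ultimately show False using quorum[of v] v Sdom by auto
  qed
  then have "two_independent G S" using Sdom dom by (auto simp: two_independent_def)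
  then show ?thesis using card by blast
qed

lemma (in graph) sub_quorum_coloring_number_eq_two_independence_number:
  assumes "\<And>v. v \<in> verts G \<Longrightarrow> card {u \<in> verts G. v \<rightarrow>\<^bsub>G\<^esub> u} \<le> 2"
  shows "sub_quorum_coloring_number G = two_independence_number G"
proof -
  \<comment> \<open>Both translations preserve the number exactly, so the sets of attained values
    coincide and not merely their maxima.\<close>
  have "{l. \<exists>f. sub_quorum_coloring G l f} = {card S | S. two_independent G S}"
    using two_independent_imp_sub_quorum_coloring
      sub_quorum_coloring_imp_two_independent[OF assms] by blast
  then show ?thesis
    by (simp add: sub_quorum_coloring_number_def two_independence_number_def)
qed

lemma card_path_graph_nbhd_le:
  "card {u \<in> verts (path_graph n). v \<rightarrow>\<^bsub>path_graph n\<^esub> u} \<le> 2"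
proof -
  have "card {u \<in> verts (path_graph n). v \<rightarrow>\<^bsub>path_graph n\<^esub> u} \<le> card {v - 1, Suc v}"
    by (rule card_mono) (auto simp: adj_path_graph)
  also have "\<dots> \<le> 2" by (simp add: card_insert_if)
  finally show ?thesis .
qed

text \<open>The only possible neighbors of a vertex are its predecessor and its successor, so a
  vertex violates the degree condition exactly when it is the middle of a run of three in
  \<open>S\<close>.\<close>

lemma two_independent_path_graph_iff:
  "two_independent (path_graph n) S \<longleftrightarrow>
     S \<subseteq> {1..n} \<and> (\<forall>k. \<not> {k, Suc k, Suc (Suc k)} \<subseteq> S)"
proof (intro iffI conjI allI notI)
  assume S: "two_independent (path_graph n) S"
  then show sub: "S \<subseteq> {1..n}" by (simp add: two_independent_def)
  fix k assume k: "{k, Suc k, Suc (Suc k)} \<subseteq> S"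
  have "finite S" using sub finite_subset by blast
  then have "card {k, Suc (Suc k)} \<le> card {u \<in> S. Suc k \<rightarrow>\<^bsub>path_graph n\<^esub> u}"
    using k sub by (intro card_mono) (auto simp: adj_path_graph)
  also have "\<dots> \<le> 1" using S k by (simp add: two_independent_def)
  finally show False by simp
next
  assume S: "S \<subseteq> {1..n} \<and> (\<forall>k. \<not> {k, Suc k, Suc (Suc k)} \<subseteq> S)"
  have "card {u \<in> S. v \<rightarrow>\<^bsub>path_graph n\<^esub> u} \<le> 1" if v: "v \<in> S" for v
  proof -
    \<comment> \<open>Vertices start at 1, so \<open>v\<close> has a predecessor \<open>k\<close> in
      the naturals; if \<open>k\<close> is 0, it lies outside \<open>S\<close>.\<close>
    obtain k where k: "v = Suc k" using v S by (cases v) auto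
    have "{u \<in> S. v \<rightarrow>\<^bsub>path_graph n\<^esub> u} \<subseteq> {k} \<or>
        {u \<in> S. v \<rightarrow>\<^bsub>path_graph n\<^esub> u} \<subseteq> {Suc (Suc k)}"
      using S v k by (auto simp: adj_path_graph)
    then show ?thesis by (auto dest!: card_mono[rotated])
  qed
  then show "two_independent (path_graph n) S" using S by (simp add: two_independent_def)
qed

text \<open>Induction in steps of three: \<open>S\<close> misses one of the last three numbers, and
  the bound grows by 2 when \<open>n\<close> grows by 3. For \<open>n < 3\<close> the bound equals
  \<open>n\<close>.\<close>

lemma card_no_three_consecutive_le:
  fixes S :: "nat set"
  assumes "\<And>k. \<not> {k, Suc k, Suc (Suc k)} \<subseteq> S"
  shows "card (S \<inter> {1..n}) \<le> (2 * n + 2) div 3"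
proof (induction n rule: less_induct)
  case (less n)
  show ?case
  proof (cases "n < 3")
    case True
    have "card (S \<inter> {1..n}) \<le> card {1..n}" by (rule card_mono) auto
    then show ?thesis using True by auto
  next
    case False
    then obtain m where n: "n = m + 3" by (metis add.commute le_Suc_ex not_less)
    let ?T = "{Suc m, Suc (Suc m), Suc (Suc (Suc m))}"
    have "S \<inter> ?T \<subset> ?T" using assms[of "Suc m"] by blast
    then have "card (S \<inter> ?T) < card ?T" by (intro psubset_card_mono) auto
    then have "card (S \<inter> ?T) \<le> 2" by simp
    moreover have "S \<inter> {1..n} = S \<inter> {1..m} \<union> S \<inter> ?T" by (auto simp: n)
    then have "card (S \<inter> {1..n}) \<le> card (S \<inter> {1..m}) + card (S \<inter> ?T)"
      using card_Un_le by metis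
    ultimately show ?thesis using less[of m] n by simp
  qed
qed

text \<open>Dropping every third vertex gives the extremal set: the quotient stays constant exactly
  on the steps that reach a multiple of 3.\<close>

lemma card_not_dvd_3: "card {i \<in> {1..n}. \<not> 3 dvd i} = (2 * n + 2) div 3" for n :: nat
proof (induction n)
  case (Suc n)
  have "{i \<in> {1..Suc n}. \<not> 3 dvd i} =
      (if 3 dvd Suc n then {i \<in> {1..n}. \<not> 3 dvd i} else insert (Suc n) {i \<in> {1..n}. \<not> 3 dvd i})"
    by (auto simp: le_Suc_eq)
  then have "card {i \<in> {1..Suc n}. \<not> 3 dvd i} = (2 * n + 2) div 3 + (if 3 dvd Suc n then 0 else 1)"
    using Suc by auto
  moreover have "(2 * Suc n + 2) div 3 = (2 * n + 2) div 3 + (if 3 dvd Suc n then 0 else 1)"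
    by presburger
  ultimately show ?case by simp
qed simp

lemma two_independence_number_path_graph:
  "two_independence_number (path_graph n) = (2 * n + 2) div 3"
  unfolding two_independence_number_def
proof (rule Max_eqI)
  show "finite {card S | S. two_independent (path_graph n) S}"
    by (rule graph.two_independent_sizes(1)[OF graph_path_graph])
  fix k assume "k \<in> {card S | S. two_independent (path_graph n) S}"
  then obtain S where "k = card S" "S \<subseteq> {1..n}" "\<And>k. \<not> {k, Suc k, Suc (Suc k)} \<subseteq> S"
    unfolding two_independent_path_graph_iff by blast
  then show "k \<le> (2 * n + 2) div 3"
    using card_no_three_consecutive_le[of S n] by (simp add: Int_absorb2)
next
  have "\<not> {k, Suc k, Suc (Suc k)} \<subseteq> {i \<in> {1..n}. \<not> 3 dvd i}" for k
  proof -
    have "3 dvd k \<or> 3 dvd Suc k \<or> 3 dvd Suc (Suc k)" by presburger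
    then show ?thesis by auto
  qed
  then have "two_independent (path_graph n) {i \<in> {1..n}. \<not> 3 dvd i}"
    unfolding two_independent_path_graph_iff by blast
  then show "(2 * n + 2) div 3 \<in> {card S | S. two_independent (path_graph n) S}"
    using card_not_dvd_3[of n] by (metis (mono_tags, lifting) mem_Collect_eq)
qed

theorem proposition13:
  fixes n :: nat
  assumes "n \<ge> 1"
  shows "sub_quorum_coloring_number (path_graph n) = two_independence_number (path_graph n) \<and>
         int (two_independence_number (path_graph n)) = \<lceil>2 * real n / 3\<rceil>"
proof
  show "sub_quorum_coloring_number (path_graph n) = two_independence_number (path_graph n)"
    by (rule graph.sub_quorum_coloring_number_eq_two_independence_number
        [OF graph_path_graph card_path_graph_nbhd_le])
  \<comment> \<open>With \<open>q\<close> for the quotient, division by 3 turns these into q - 1 <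
    2n/3 \<le> q, which characterizes the ceiling.\<close>
  have "3 * ((2 * n + 2) div 3) < 2 * n + 3" "2 * n \<le> 3 * ((2 * n + 2) div 3)"
    by presburger+
  then have "\<lceil>2 * real n / 3\<rceil> = int ((2 * n + 2) div 3)"
    by (intro ceiling_unique) linarith+
  then show "int (two_independence_number (path_graph n)) = \<lceil>2 * real n / 3\<rceil>"
    by (simp add: two_independence_number_path_graph)
qed

end
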